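(* Let $G$ be a connected infinite graph. Then $\chi'_D(G)\leq \chi'(G)+1$, where $\chi'_D(G)$ is the distinguishing chromatic index and $\chi'(G)$ is the chromatic index of $G$.
   Context: Graphs are simple and undirected; a graph is infinite if it has infinitely many vertices (no countability or local finiteness is assumed). A proper edge colouring is one in which edges sharing an endpoint have distinct colours. The chromatic index $\chi'(G)$ is the least cardinal number of colours in a proper edge colouring of $G$. The distinguishing chromatic index $\chi'_D(G)$ is the least cardinal number of colours in a proper edge colouring $c$ of $G$ that is preserved only by the trivial automorphism, where an automorphism $\varphi$ preserves $c$ if $c(\varphi(x)\varphi(y))=c(xy)$ for all edges $xy$. These invariants may be infinite cardinals. *)

theory Defs
  imports Main
begin

unbundle cardinal_syntax

definition simple_graph :: "'a set \<Rightarrow> 'a set set \<Rightarrow> bool" where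
  "simple_graph V E \<longleftrightarrow> (\<forall>e\<in>E. e \<subseteq> V \<and> card e = 2)"

definition connected_graph :: "'a set \<Rightarrow> 'a set set \<Rightarrow> bool" where
  "connected_graph V E \<longleftrightarrow>
     V \<noteq> {} \<and> (\<forall>u\<in>V. \<forall>v\<in>V. (u, v) \<in> {(x, y). {x, y} \<in> E}\<^sup>*)"

definition graph_automorphism :: "'a set \<Rightarrow> 'a set set \<Rightarrow> ('a \<Rightarrow> 'a) \<Rightarrow> bool" where
  "graph_automorphism V E \<phi> \<longleftrightarrow>
     bij_betw \<phi> V V \<and> (\<forall>x\<in>V. \<forall>y\<in>V. {x, y} \<in> E \<longleftrightarrow> {\<phi> x, \<phi> y} \<in> E)"

text \<open>Only the values of a colouring on \<open>E\<close> are relevant; the colours used are \<open>c ` E\<close>.\<close>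

definition proper_edge_colouring :: "'a set set \<Rightarrow> ('a set \<Rightarrow> 'c) \<Rightarrow> bool" where
  "proper_edge_colouring E c \<longleftrightarrow>
     (\<forall>e\<in>E. \<forall>f\<in>E. e \<noteq> f \<and> e \<inter> f \<noteq> {} \<longrightarrow> c e \<noteq> c f)"

definition preserves_edge_colouring :: "'a set set \<Rightarrow> ('a \<Rightarrow> 'a) \<Rightarrow> ('a set \<Rightarrow> 'c) \<Rightarrow> bool" where
  "preserves_edge_colouring E \<phi> c \<longleftrightarrow> (\<forall>x y. {x, y} \<in> E \<longrightarrow> c {\<phi> x, \<phi> y} = c {x, y})"

definition distinguishing_edge_colouring ::
    "'a set \<Rightarrow> 'a set set \<Rightarrow> ('a set \<Rightarrow> 'c) \<Rightarrow> bool" where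
  "distinguishing_edge_colouring V E c \<longleftrightarrow>
     (\<forall>\<phi>. graph_automorphism V E \<phi> \<and> preserves_edge_colouring E \<phi> c \<longrightarrow> (\<forall>x\<in>V. \<phi> x = x))"

definition least_cardinal :: "'b rel set \<Rightarrow> 'b rel" where
  "least_cardinal R = (SOME r. r \<in> R \<and> (\<forall>s\<in>R. r \<le>o s))"

text \<open>
  Cardinals are represented by cardinal orders, compared with \<open>\<le>o\<close>. Since a colouring of \<open>E\<close>
  uses at most \<open>|E|\<close> colours, colours of type \<open>'a set\<close> (the type of edges) suffice; the lemmas
  \<open>chromatic_index_least\<close> and \<open>distinguishing_chromatic_index_least\<close> below show that the minimum
  is also a lower bound for colourings with colours from an arbitrary type.
\<close>

definition chromatic_index :: "'a set set \<Rightarrow> 'a set rel" where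
  "chromatic_index E =
     least_cardinal {|c ` E| | c :: 'a set \<Rightarrow> 'a set. proper_edge_colouring E c}"

definition distinguishing_chromatic_index :: "'a set \<Rightarrow> 'a set set \<Rightarrow> 'a set rel" where
  "distinguishing_chromatic_index V E =
     least_cardinal {|c ` E| | c :: 'a set \<Rightarrow> 'a set.
       proper_edge_colouring E c \<and> distinguishing_edge_colouring V E c}"

lemma least_cardinal:
  assumes "R \<noteq> {}" and "\<And>r. r \<in> R \<Longrightarrow> Card_order r"
  shows "least_cardinal R \<in> R" and "s \<in> R \<Longrightarrow> least_cardinal R \<le>o s"
proof -
  have "\<exists>r. r \<in> R \<and> (\<forall>s\<in>R. r \<le>o s)"
    using exists_minim_Card_order[of R] assms by blast
  then have "least_cardinal R \<in> R \<and> (\<forall>s\<in>R. least_cardinal R \<le>o s)"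
    unfolding least_cardinal_def by (rule someI_ex)
  then show "least_cardinal R \<in> R" and "s \<in> R \<Longrightarrow> least_cardinal R \<le>o s" by blast+
qed

lemma chromatic_index_attained:
  obtains c :: "'a set \<Rightarrow> 'a set"
  where "proper_edge_colouring E c" and "chromatic_index E = |c ` E|"
proof -
  let ?R = "{|c ` E| | c :: 'a set \<Rightarrow> 'a set. proper_edge_colouring E c}"
  have "proper_edge_colouring E (id :: 'a set \<Rightarrow> 'a set)"
    by (simp add: proper_edge_colouring_def)
  then have "?R \<noteq> {}" by blast
  moreover have "\<And>r. r \<in> ?R \<Longrightarrow> Card_order r" using card_of_Card_order by blast
  ultimately have "least_cardinal ?R \<in> ?R" by (rule least_cardinal(1))
  then show ?thesis using that unfolding chromatic_index_def by blast
qed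

lemma recolour:
  fixes c :: "'a set \<Rightarrow> 'c"
  obtains d :: "'a set \<Rightarrow> 'a set"
  where "\<And>e f. e \<in> E \<Longrightarrow> f \<in> E \<Longrightarrow> d e = d f \<longleftrightarrow> c e = c f" and "|d ` E| \<le>o |c ` E|"
proof
  define d where "d e = inv_into E c (c e)" for e
  show "d e = d f \<longleftrightarrow> c e = c f" if "e \<in> E" "f \<in> E" for e f
    using that unfolding d_def by (metis f_inv_into_f image_eqI)
  have "d ` E = inv_into E c ` (c ` E)"
    unfolding d_def by (simp add: image_image)
  then show "|d ` E| \<le>o |c ` E|" by (metis card_of_image)
qed

lemma chromatic_index_least:
  fixes c :: "'a set \<Rightarrow> 'c"
  assumes "proper_edge_colouring E c"
  shows "chromatic_index E \<le>o |c ` E|"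
proof -
  let ?R = "{|c ` E| | c :: 'a set \<Rightarrow> 'a set. proper_edge_colouring E c}"
  obtain d :: "'a set \<Rightarrow> 'a set"
    where d: "\<And>e f. e \<in> E \<Longrightarrow> f \<in> E \<Longrightarrow> d e = d f \<longleftrightarrow> c e = c f" and le: "|d ` E| \<le>o |c ` E|"
    using recolour[of E c] by metis
  have "proper_edge_colouring E d"
    using assms d unfolding proper_edge_colouring_def by blast
  then have mem: "|d ` E| \<in> ?R" by blast
  then have "?R \<noteq> {}" by blast
  moreover have "\<And>r. r \<in> ?R \<Longrightarrow> Card_order r" using card_of_Card_order by blast
  ultimately have "least_cardinal ?R \<le>o |d ` E|" using mem by (rule least_cardinal(2))
  then show ?thesis unfolding chromatic_index_def using le by (rule ordLeq_transitive)
qed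

lemma injective_colouring_distinguishing:
  assumes "simple_graph V E" and conn: "connected_graph V E" and inf: "infinite V"
  shows "distinguishing_edge_colouring V E (id :: 'a set \<Rightarrow> 'a set)"
  unfolding distinguishing_edge_colouring_def
proof (intro allI impI ballI)
  fix \<phi> x
  assume \<phi>: "graph_automorphism V E \<phi> \<and> preserves_edge_colouring E \<phi> (id :: 'a set \<Rightarrow> 'a set)"
    and x: "x \<in> V"
  have fixes_edges: "{\<phi> u, \<phi> v} = {u, v}" if "{u, v} \<in> E" for u v
    using \<phi> that unfolding preserves_edge_colouring_def by simp
  have nbr: "v = \<phi> u \<and> u = \<phi> v" if "{u, v} \<in> E" "\<phi> u \<noteq> u" for u v
    using fixes_edges[OF that(1)] that(2) by (auto simp: doubleton_eq_iff)
  show "\<phi> x = x"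
  proof (rule ccontr)
    assume "\<phi> x \<noteq> x"
    have "v = x \<or> v = \<phi> x \<and> (v \<noteq> x \<longrightarrow> \<phi> v = x)" if "(x, v) \<in> {(x, y). {x, y} \<in> E}\<^sup>*" for v
      using that
    proof (induction rule: rtrancl_induct)
      case base
      show ?case by simp
    next
      case (step u v)
      then have "{u, v} \<in> E" by simp
      moreover have "\<phi> u \<noteq> u" using step.IH \<open>\<phi> x \<noteq> x\<close> by metis
      ultimately show ?case using nbr[of u v] step.IH by metis
    qed
    then have "V \<subseteq> {x, \<phi> x}"
      using conn x unfolding connected_graph_def by blast
    then show False using inf finite_subset by blast
  qed
qed

lemma distinguishing_chromatic_index_attained:
  fixes V :: "'a set"
  assumes "simple_graph V E" and "connected_graph V E" and "infinite V"
  obtains c :: "'a set \<Rightarrow> 'a set"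
  where "proper_edge_colouring E c" and "distinguishing_edge_colouring V E c"
    and "distinguishing_chromatic_index V E = |c ` E|"
proof -
  let ?R = "{|c ` E| | c :: 'a set \<Rightarrow> 'a set.
    proper_edge_colouring E c \<and> distinguishing_edge_colouring V E c}"
  have "proper_edge_colouring E (id :: 'a set \<Rightarrow> 'a set)"
    by (simp add: proper_edge_colouring_def)
  then have "?R \<noteq> {}" using injective_colouring_distinguishing[OF assms] by blast
  moreover have "\<And>r. r \<in> ?R \<Longrightarrow> Card_order r" using card_of_Card_order by blast
  ultimately have "least_cardinal ?R \<in> ?R" by (rule least_cardinal(1))
  then show ?thesis using that unfolding distinguishing_chromatic_index_def by blast
qed

lemma distinguishing_chromatic_index_least:
  fixes c :: "'a set \<Rightarrow> 'c"
  assumes "simple_graph V E"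
    and "proper_edge_colouring E c" and "distinguishing_edge_colouring V E c"
  shows "distinguishing_chromatic_index V E \<le>o |c ` E|"
proof -
  let ?R = "{|c ` E| | c :: 'a set \<Rightarrow> 'a set.
    proper_edge_colouring E c \<and> distinguishing_edge_colouring V E c}"
  obtain d :: "'a set \<Rightarrow> 'a set"
    where d: "\<And>e f. e \<in> E \<Longrightarrow> f \<in> E \<Longrightarrow> d e = d f \<longleftrightarrow> c e = c f" and le: "|d ` E| \<le>o |c ` E|"
    using recolour[of E c] by metis
  have proper: "proper_edge_colouring E d"
    using assms(2) d unfolding proper_edge_colouring_def by blast
  have "preserves_edge_colouring E \<phi> c"
    if "graph_automorphism V E \<phi>" "preserves_edge_colouring E \<phi> d" for \<phi>
    unfolding preserves_edge_colouring_def
  proof (intro allI impI)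
    fix x y
    assume e: "{x, y} \<in> E"
    then have "x \<in> V" "y \<in> V" using assms(1) unfolding simple_graph_def by auto
    then have "{\<phi> x, \<phi> y} \<in> E" using e that(1) unfolding graph_automorphism_def by blast
    moreover have "d {\<phi> x, \<phi> y} = d {x, y}"
      using e that(2) unfolding preserves_edge_colouring_def by blast
    ultimately show "c {\<phi> x, \<phi> y} = c {x, y}" using d e by blast
  qed
  then have "distinguishing_edge_colouring V E d"
    using assms(3) unfolding distinguishing_edge_colouring_def by blast
  with proper have mem: "|d ` E| \<in> ?R" by blast
  then have "?R \<noteq> {}" by blast
  moreover have "\<And>r. r \<in> ?R \<Longrightarrow> Card_order r" using card_of_Card_order by blast
  ultimately have "least_cardinal ?R \<le>o |d ` E|" using mem by (rule least_cardinal(2))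
  then show ?thesis unfolding distinguishing_chromatic_index_def using le
    by (rule ordLeq_transitive)
qed

end

(* A colour-preserving automorphism of a properly coloured connected graph that fixes one vertex
   fixes every vertex, because the edges at a vertex have distinct colours. If the chromatic index is
   infinite, it equals the number of edges, and giving all edges distinct colours works. If it is
   finite, then G is locally finite, hence contains a geodesic p0 ... p6. Recolour the matching
   p0p1, p2p3, p5p6 with a new colour: an automorphism preserving the new colouring acts isometrically
   on the six matched vertices, hence maps p0 to p0 or p6; the latter would map p2 to a matched vertex
   at distance 2 from p6, and p4 is not matched. *)
theory Submission
  imports Defs
begin

text \<open>Taking adjacency as a relation turns walks of length \<open>n\<close> into the
  relational power \<open>adj E ^^ n\<close>.\<close>

definition adj :: "'a set set \<Rightarrow> 'a rel" where
  "adj E = {(x, y). {x, y} \<in> E}"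

lemma adj_iff [simp]: "(x, y) \<in> adj E \<longleftrightarrow> {x, y} \<in> E"
  by (simp add: adj_def)

lemma simple_graph_edgeD:
  assumes "simple_graph V E" and "{x, y} \<in> E"
  shows "x \<in> V" and "y \<in> V"
  using assms unfolding simple_graph_def by auto

lemma simple_graph_edge_cases:
  assumes "simple_graph V E" and "e \<in> E"
  obtains x y where "x \<in> V" and "y \<in> V" and "e = {x, y}"
proof -
  have "card e = 2" "e \<subseteq> V" using assms unfolding simple_graph_def by auto
  then show thesis using that by (auto simp: card_2_iff)
qed

lemma adj_relpow_sym: "(x, y) \<in> adj E ^^ n \<Longrightarrow> (y, x) \<in> adj E ^^ n"
proof (induction n arbitrary: y)
  case (Suc n)
  then obtain z where "(x, z) \<in> adj E ^^ n" "(z, y) \<in> adj E" by auto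
  then show ?case using Suc.IH by (metis adj_iff insert_commute relpow_Suc_I2)
qed simp

lemma connected_graph_relpow:
  assumes "connected_graph V E" and "x \<in> V" and "y \<in> V"
  obtains n where "(x, y) \<in> adj E ^^ n"
proof -
  have "(x, y) \<in> (adj E)\<^sup>*"
    using assms unfolding connected_graph_def adj_def by blast
  then show thesis using that rtrancl_imp_relpow by metis
qed


subsection \<open>Automorphisms preserving a proper edge colouring\<close>

lemma proper_edge_colouringD:
  assumes "proper_edge_colouring E c" and "e \<in> E" and "f \<in> E" and "c e = c f"
    and "x \<in> e" and "x \<in> f"
  shows "e = f"
  using assms unfolding proper_edge_colouring_def by (metis IntI empty_iff)

text \<open>Fixed points spread along edges: if \<open>u\<close> is fixed, then
  \<open>{u, v}\<close> and \<open>{u, \<phi> v}\<close> are edges at \<open>u\<close> of the same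
  colour, so properness makes them equal.\<close>

lemma colour_preserving_fixes_all:
  assumes simple: "simple_graph V E" and conn: "connected_graph V E"
    and proper: "proper_edge_colouring E c"
    and aut: "graph_automorphism V E \<phi>" and pres: "preserves_edge_colouring E \<phi> c"
    and x: "x \<in> V" "\<phi> x = x" and y: "y \<in> V"
  shows "\<phi> y = y"
proof -
  have "(x, y) \<in> {(x, y). {x, y} \<in> E}\<^sup>*"
    using conn x(1) y unfolding connected_graph_def by blast
  then show ?thesis
  proof (induction rule: rtrancl_induct)
    case base
    show ?case by (rule x(2))
  next
    case (step u v)
    then have uv: "{u, v} \<in> E" by simp
    have img: "{u, \<phi> v} \<in> E"
      using aut uv simple_graph_edgeD[OF simple uv] step.IH
      unfolding graph_automorphism_def by metis
    have "c {u, \<phi> v} = c {u, v}"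
      using pres uv step.IH unfolding preserves_edge_colouring_def by metis
    then have "{u, \<phi> v} = {u, v}"
      by (rule proper_edge_colouringD[OF proper img uv, of u]) simp_all
    then show "\<phi> v = v" by (auto simp: doubleton_eq_iff)
  qed
qed


subsection \<open>Distances\<close>

text \<open>For vertices joined by no walk the value is arbitrary; between vertices of a connected
  graph it is the usual distance.\<close>

definition gdist :: "'a set set \<Rightarrow> 'a \<Rightarrow> 'a \<Rightarrow> nat" where
  "gdist E x y = (LEAST n. (x, y) \<in> adj E ^^ n)"

lemma automorphism_relpow_iff:
  assumes simple: "simple_graph V E" and aut: "graph_automorphism V E \<phi>"
    and "x \<in> V" and "y \<in> V"
  shows "(\<phi> x, \<phi> y) \<in> adj E ^^ n \<longleftrightarrow> (x, y) \<in> adj E ^^ n"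
  using assms(4)
proof (induction n arbitrary: y)
  case 0
  have "inj_on \<phi> V" using aut unfolding graph_automorphism_def bij_betw_def by blast
  then show ?case using 0 assms(3) by (auto dest: inj_onD)
next
  case (Suc n)
  have surj: "\<phi> ` V = V"
    and edge: "\<And>u v. u \<in> V \<Longrightarrow> v \<in> V \<Longrightarrow> {\<phi> u, \<phi> v} \<in> E \<longleftrightarrow> {u, v} \<in> E"
    using aut unfolding graph_automorphism_def bij_betw_def by blast+
  show ?case
  proof
    assume "(\<phi> x, \<phi> y) \<in> adj E ^^ Suc n"
    then obtain w where w: "(\<phi> x, w) \<in> adj E ^^ n" "{w, \<phi> y} \<in> E" by auto
    \<comment> \<open>The penultimate vertex of the walk lies on an edge, hence in \<open>V\<close>,
      so surjectivity pulls it back and the induction applies to the preimage.\<close>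
    then obtain z where "z \<in> V" "w = \<phi> z"
      using surj simple_graph_edgeD(1)[OF simple w(2)] by blast
    then show "(x, y) \<in> adj E ^^ Suc n"
      using w Suc edge by (metis adj_iff relpow_Suc_I)
  next
    assume "(x, y) \<in> adj E ^^ Suc n"
    then obtain z where z: "(x, z) \<in> adj E ^^ n" "{z, y} \<in> E" by auto
    then have "z \<in> V" using simple_graph_edgeD(1)[OF simple] by blast
    then show "(\<phi> x, \<phi> y) \<in> adj E ^^ Suc n"
      using z Suc edge by (metis adj_iff relpow_Suc_I)
  qed
qed

lemma gdist_automorphism:
  assumes "simple_graph V E" and "graph_automorphism V E \<phi>" and "x \<in> V" and "y \<in> V"
  shows "gdist E (\<phi> x) (\<phi> y) = gdist E x y"
  unfolding gdist_def using automorphism_relpow_iff[OF assms] by simp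

text \<open>Walks of length below \<open>k\<close> from a vertex \<open>x\<close> reach only
  finitely many vertices, so some \<open>y\<close> lies at distance at least \<open>k\<close>; the
  first \<open>k + 1\<close> vertices of a shortest walk to \<open>y\<close> serve as
  \<open>p\<close>. With truncated subtraction, \<open>(i - j) + (j - i)\<close> is the absolute
  difference.\<close>

lemma geodesic_exists:
  assumes simple: "simple_graph V E" and conn: "connected_graph V E" and inf: "infinite V"
    and fin: "\<And>x n. x \<in> V \<Longrightarrow> finite {y. (x, y) \<in> adj E ^^ n}"
  obtains p where "\<And>i. i \<le> k \<Longrightarrow> p i \<in> V" and "\<And>i. i < k \<Longrightarrow> {p i, p (Suc i)} \<in> E"
    and "\<And>i j. i \<le> k \<Longrightarrow> j \<le> k \<Longrightarrow> gdist E (p i) (p j) = (i - j) + (j - i)"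
proof -
  obtain x where x: "x \<in> V" using inf by fastforce
  have "finite (\<Union>n\<in>{..<k}. {y. (x, y) \<in> adj E ^^ n})" using fin[OF x] by blast
  then obtain y where y: "y \<in> V" "\<And>n. n < k \<Longrightarrow> (x, y) \<notin> adj E ^^ n"
    using inf by (metis (mono_tags, lifting) UN_I finite_subset lessThan_iff mem_Collect_eq subsetI)
  define N where "N = gdist E x y"
  have walk: "(x, y) \<in> adj E ^^ N"
    unfolding N_def gdist_def using connected_graph_relpow[OF conn x y(1)] by (metis LeastI)
  have short: "N \<le> n" if "(x, y) \<in> adj E ^^ n" for n
    unfolding N_def gdist_def using that by (rule Least_le)
  have kN: "k \<le> N" using walk y(2) not_le by blast
  obtain p where p: "p 0 = x" "p N = y" "\<And>i. i < N \<Longrightarrow> {p i, p (Suc i)} \<in> E"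
    using walk unfolding relpow_fun_conv by auto
  have sub: "(p i, p (i + m)) \<in> adj E ^^ m" if "i + m \<le> N" for i m
    using that
  proof (induction m)
    case (Suc m)
    then show ?case using p(3)[of "i + m"] by (auto intro: relpow_Suc_I)
  qed simp
  have dist: "gdist E (p i) (p j) = j - i" if "i \<le> j" "j \<le> N" for i j
    unfolding gdist_def
  proof (rule Least_equality)
    show "(p i, p j) \<in> adj E ^^ (j - i)" using sub[of i "j - i"] that by simp
  next
    fix n assume "(p i, p j) \<in> adj E ^^ n"
    moreover have "(x, p i) \<in> adj E ^^ i" "(p j, y) \<in> adj E ^^ (N - j)"
      using sub[of 0 i] sub[of j "N - j"] that p by auto
    \<comment> \<open>Splicing a walk of length \<open>n\<close> between \<open>p i\<close> and
      \<open>p j\<close> into the shortest walk cannot make it shorter than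
      \<open>N\<close>.\<close>
    ultimately have "(x, y) \<in> adj E ^^ (i + n + (N - j))"
      by (metis relcomp.intros relpow_add)
    then show "j - i \<le> n" using short that by fastforce
  qed
  have sym: "gdist E u v = gdist E v u" for u v
    unfolding gdist_def using adj_relpow_sym by metis
  show thesis
  proof
    show "p i \<in> V" if "i \<le> k" for i
    proof (cases "i < N")
      case True
      then show ?thesis using p(3) simple_graph_edgeD[OF simple] by blast
    next
      case False
      then have "i = N" using that kN by simp
      then show ?thesis using p(2) y(1) by simp
    qed
    show "{p i, p (Suc i)} \<in> E" if "i < k" for i using p(3) that kN by simp
    show "gdist E (p i) (p j) = (i - j) + (j - i)" if "i \<le> k" "j \<le> k" for i j
      using dist[of i j] dist[of j i] sym[of "p i" "p j"] that kN by (cases "i \<le> j") auto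
  qed
qed


subsection \<open>The size of a graph in terms of the number of colours\<close>

text \<open>The colours of the edges at \<open>x\<close> tell its neighbours apart.\<close>

lemma neighbours_le_colours:
  assumes "proper_edge_colouring E c"
  shows "|{y. {x, y} \<in> E}| \<le>o |c ` E|"
proof -
  have "inj_on (\<lambda>y. c {x, y}) {y. {x, y} \<in> E}"
  proof (rule inj_onI)
    fix y z assume "y \<in> {y. {x, y} \<in> E}" "z \<in> {y. {x, y} \<in> E}" "c {x, y} = c {x, z}"
    then have "{x, y} = {x, z}"
      using proper_edge_colouringD[OF assms, of "{x, y}" "{x, z}" x] by simp
    then show "y = z" by (auto simp: doubleton_eq_iff)
  qed
  moreover have "(\<lambda>y. c {x, y}) ` {y. {x, y} \<in> E} \<subseteq> c ` E" by blast
  ultimately show ?thesis using card_of_ordLeq by blast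
qed

text \<open>These "spheres" collect the ends of all walks of length \<open>n\<close>, so vertices
  nearer than \<open>n\<close> may belong to them.\<close>

lemma sphere_Suc:
  "{y. (x, y) \<in> adj E ^^ Suc n} = (\<Union>z\<in>{z. (x, z) \<in> adj E ^^ n}. {y. {z, y} \<in> E})"
  by auto

lemma finite_sphere:
  assumes "proper_edge_colouring E c" and "finite (c ` E)"
  shows "finite {y. (x, y) \<in> adj E ^^ n}"
proof (induction n)
  case (Suc n)
  moreover have "finite {y. {z, y} \<in> E}" for z
    using neighbours_le_colours[OF assms(1)] assms(2) by (metis card_of_ordLeq_finite)
  ultimately show ?case unfolding sphere_Suc by blast
qed simp

text \<open>An infinite cardinal absorbs a union of at most that many sets, each of at most that
  size.\<close>

lemma sphere_le_colours:
  assumes "proper_edge_colouring E c" and "infinite (c ` E)"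
  shows "|{y. (x, y) \<in> adj E ^^ n}| \<le>o |c ` E|"
proof (induction n)
  case 0
  have "c ` E \<noteq> {}" using assms(2) by force
  then show ?case by (simp add: card_of_singl_ordLeq)
next
  case (Suc n)
  show ?case unfolding sphere_Suc
    by (intro card_of_UNION_ordLeq_infinite[OF assms(2) Suc] ballI neighbours_le_colours assms(1))
qed

text \<open>\<open>V\<close> is covered by countably many spheres and \<open>E\<close> by the stars
  at the vertices, so the same absorption applies twice.\<close>

lemma edges_le_colours:
  assumes simple: "simple_graph V E" and conn: "connected_graph V E"
    and proper: "proper_edge_colouring E c" and inf: "infinite (c ` E)"
  shows "|E| \<le>o |c ` E|"
proof -
  obtain x where x: "x \<in> V" using conn unfolding connected_graph_def by blast
  have "|UNIV :: nat set| \<le>o |c ` E|" using inf infinite_iff_card_of_nat by blast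
  then have "|\<Union>n. {y. (x, y) \<in> adj E ^^ n}| \<le>o |c ` E|"
    by (intro card_of_UNION_ordLeq_infinite[OF inf] ballI sphere_le_colours proper inf)
  moreover have "V \<subseteq> (\<Union>n. {y. (x, y) \<in> adj E ^^ n})"
    using connected_graph_relpow[OF conn x] by blast
  ultimately have V: "|V| \<le>o |c ` E|"
    using card_of_mono1 ordLeq_transitive by blast
  have "|(\<lambda>w. {v, w}) ` {w. {v, w} \<in> E}| \<le>o |c ` E|" for v
    by (rule ordLeq_transitive[OF card_of_image neighbours_le_colours[OF proper]])
  then have "|\<Union>v\<in>V. (\<lambda>w. {v, w}) ` {w. {v, w} \<in> E}| \<le>o |c ` E|"
    by (intro card_of_UNION_ordLeq_infinite[OF inf V] ballI)
  moreover have "E \<subseteq> (\<Union>v\<in>V. (\<lambda>w. {v, w}) ` {w. {v, w} \<in> E})"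
  proof
    fix e assume e: "e \<in> E"
    obtain v w where "v \<in> V" "e = {v, w}" by (rule simple_graph_edge_cases[OF simple e])
    then show "e \<in> (\<Union>v\<in>V. (\<lambda>w. {v, w}) ` {w. {v, w} \<in> E})" using e by blast
  qed
  ultimately show ?thesis using card_of_mono1 ordLeq_transitive by blast
qed


subsection \<open>Recolouring a matching on a geodesic\<close>

text \<open>\<open>None\<close> plays the new colour, and \<open>cone\<close> is the cardinal of the
  singleton \<open>{()}\<close> that accounts for it.\<close>

lemma card_of_option_colouring:
  assumes "c' ` E \<subseteq> insert None (Some ` c ` E)"
  shows "|c' ` E| \<le>o |c ` E| +c cone"
proof -
  have "insert None (Some ` c ` E) = case_sum Some (\<lambda>_. None) ` (c ` E <+> {()})"
    by (force simp: image_iff)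
  then have "|c' ` E| \<le>o |c ` E <+> {()}|"
    using assms card_of_mono1 card_of_image ordLeq_transitive by metis
  then show ?thesis unfolding csum_def cone_def by (simp add: Field_card_of)
qed

lemma distinguishing_recolouring:
  assumes simple: "simple_graph V E" and conn: "connected_graph V E"
    and proper: "proper_edge_colouring E c"
    and pV: "\<And>i. i \<le> 6 \<Longrightarrow> p i \<in> V" and pE: "\<And>i. i < 6 \<Longrightarrow> {p i, p (Suc i)} \<in> E"
    and dist: "\<And>i j. i \<le> 6 \<Longrightarrow> j \<le> 6 \<Longrightarrow> gdist E (p i) (p j) = (i - j) + (j - i)"
    and M: "M = {{p 0, p 1}, {p 2, p 3}, {p 5, p (6::nat)}}"
    and c': "c' = (\<lambda>e. if e \<in> M then None else Some (c e))"
  shows "proper_edge_colouring E c'" and "distinguishing_edge_colouring V E c'"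
proof -
  \<comment> \<open>Equal vertices are at distance 0, which forces equal indices.\<close>
  have p_inj: "i = j" if "p i = p j" "i \<le> 6" "j \<le> 6" for i j
    using dist[of i j] dist[of i i] that by simp
  have disjoint: "e \<inter> f = {}" if "e \<in> M" "f \<in> M" "e \<noteq> f" for e f
    using that unfolding M by (auto dest!: p_inj)
  show proper': "proper_edge_colouring E c'"
    unfolding proper_edge_colouring_def
  proof (intro ballI impI)
    fix e f assume "e \<in> E" "f \<in> E" and ef: "e \<noteq> f \<and> e \<inter> f \<noteq> {}"
    then have "c e \<noteq> c f" using proper unfolding proper_edge_colouring_def by blast
    moreover have "e \<notin> M \<or> f \<notin> M" using disjoint ef by blast
    ultimately show "c' e \<noteq> c' f" unfolding c' by auto
  qed
  \<comment> \<open>The indices of the matched vertices; the set is not invariant under the reversal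
    sending \<open>i\<close> to \<open>6 - i\<close>, since it contains 2 but not 4.\<close>
  define I where "I = {0, 1, 2, 3, 5, 6::nat}"
  have ends: "\<Union>M = p ` I" unfolding M I_def by auto
  have ME: "M \<subseteq> E" using pE[of 0] pE[of 2] pE[of 5] unfolding M by auto
  show "distinguishing_edge_colouring V E c'"
    unfolding distinguishing_edge_colouring_def
  proof (intro allI impI, elim conjE)
    fix \<phi>
    assume aut: "graph_automorphism V E \<phi>" and pres: "preserves_edge_colouring E \<phi> c'"
    \<comment> \<open>Only edges of \<open>M\<close> have colour \<open>None\<close>, so a
      colour-preserving map sends \<open>M\<close> into itself.\<close>
    have imgM: "\<phi> ` e \<in> M" if e: "e \<in> M" for e
    proof -
      obtain u v where uv: "e = {u, v}"
        using simple_graph_edge_cases[OF simple subsetD[OF ME e]] by metis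
      then have "c' (\<phi> ` e) = c' e"
        using pres e ME unfolding preserves_edge_colouring_def by auto
      then show ?thesis using e unfolding c' by (auto split: if_splits)
    qed
    have img: "\<exists>j\<in>I. \<phi> (p i) = p j" if "i \<in> I" for i
    proof -
      have "p i \<in> \<Union>M" using that ends by simp
      then have "\<phi> (p i) \<in> \<Union>M" using imgM by blast
      then show ?thesis using ends by auto
    qed
    have "0 \<in> I" "6 \<in> I" "2 \<in> I" unfolding I_def by simp_all
    then obtain a b d where abd: "a \<in> I" "b \<in> I" "d \<in> I"
      and \<phi>: "\<phi> (p 0) = p a" "\<phi> (p 6) = p b" "\<phi> (p 2) = p d"
      using img by metis
    have le: "i \<le> 6" if "i \<in> I" for i using that unfolding I_def by auto
    have iso: "gdist E (\<phi> (p i)) (\<phi> (p j)) = (i - j) + (j - i)" if "i \<le> 6" "j \<le> 6" for i j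
      using gdist_automorphism[OF simple aut pV pV] dist that by simp
    have ab: "(a - b) + (b - a) = 6" and ad: "(a - d) + (d - a) = 2"
      using iso[of 0 6] iso[of 0 2] \<phi> dist[OF le le] abd by simp_all
    \<comment> \<open>In \<open>I\<close> only 0 and 6 differ by 6, so \<open>a\<close> is 0 or 6;
      \<open>a = 6\<close> would give \<open>d = 4\<close>, which is not in
      \<open>I\<close>.\<close>
    have "a = 0" using ab ad abd unfolding I_def by auto
    then have "\<phi> (p 0) = p 0" using \<phi>(1) by simp
    then show "\<forall>x\<in>V. \<phi> x = x"
      using colour_preserving_fixes_all[OF simple conn proper' aut pres] pV[of 0] by simp
  qed
qed

theorem theorem14:
  fixes V :: "'a set" and E :: "'a set set"
  assumes "simple_graph V E" and "connected_graph V E" and "infinite V"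
  shows "distinguishing_chromatic_index V E \<le>o chromatic_index E +c cone"
proof -
  obtain c :: "'a set \<Rightarrow> 'a set"
    where proper: "proper_edge_colouring E c" and c: "chromatic_index E = |c ` E|"
    by (rule chromatic_index_attained)
  show ?thesis
  proof (cases "finite (c ` E)")
    case True
    obtain p where p: "\<And>i. i \<le> 6 \<Longrightarrow> p i \<in> V" "\<And>i. i < 6 \<Longrightarrow> {p i, p (Suc i)} \<in> E"
      "\<And>i j. i \<le> 6 \<Longrightarrow> j \<le> 6 \<Longrightarrow> gdist E (p i) (p j) = (i - j) + (j - i)"
      using geodesic_exists[OF assms finite_sphere[OF proper True], where k = 6] by metis
    define M where "M = {{p 0, p 1}, {p 2, p 3}, {p 5, p (6::nat)}}"
    define c' where "c' = (\<lambda>e. if e \<in> M then None else Some (c e))"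
    note c' = distinguishing_recolouring[OF assms(1,2) proper p M_def c'_def]
    \<comment> \<open>The lower-bound lemma admits colours of any type, here the option type that
      supplies the fresh colour.\<close>
    have "distinguishing_chromatic_index V E \<le>o |c' ` E|"
      using distinguishing_chromatic_index_least[OF assms(1) c'] .
    moreover have "|c' ` E| \<le>o |c ` E| +c cone"
      by (rule card_of_option_colouring) (auto simp: c'_def)
    ultimately show ?thesis unfolding c by (rule ordLeq_transitive)
  next
    case False
    have "proper_edge_colouring E (id :: 'a set \<Rightarrow> 'a set)"
      by (simp add: proper_edge_colouring_def)
    then have "distinguishing_chromatic_index V E \<le>o |E|"
      using distinguishing_chromatic_index_least[OF assms(1)]
        injective_colouring_distinguishing[OF assms] by fastforce
    moreover have "|E| \<le>o |c ` E|" using edges_le_colours[OF assms(1,2) proper False] .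
    moreover have "|c ` E| \<le>o |c ` E| +c cone"
      by (rule ordLeq_csum1[OF card_of_Card_order])
    ultimately show ?thesis unfolding c using ordLeq_transitive by blast
  qed
qed

end
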